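(* There exists a generalized pentagonal geometry $\mathrm{PENT}(4,r,13)$ with connected deficiency graph of girth $5$ for each $r \in \{112, 116, 120, 124, 128, 132, 136, 140, 144, 148, 152, 156, 160, 164\}$.
   Context: A Steiner system $S(2,k,w)$ is a pair $(W,\mathcal{B})$ where $W$ is a set of $w$ points and $\mathcal{B}$ is a set of $k$-subsets of $W$ (blocks) such that each pair of distinct points of $W$ lies in exactly one block. A generalized pentagonal geometry $\mathrm{PENT}(k,r,w)$ (with $k\ge 2$, $w\ge k$) is a (nonempty) partial linear space, i.e. a set of points together with a set of lines (sets of points) such that any two distinct points lie on at most one common line, in which every line contains exactly $k$ points, every point is on exactly $r$ lines, and for each point $x$ the set $W_x$ of points $y \ne x$ that are not collinear with $x$ (i.e. not on a common line with $x$) is the point set of a Steiner system $S(2,k,w)$ all of whose blocks are lines of the geometry. The deficiency graph of such a geometry has the points as vertices, with two distinct points adjacent precisely when they are not collinear. *)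

theory Defs
  imports "Graph_Theory.Graph_Theory" "HOL-Library.Extended_Nat"
begin

definition steiner_system :: "nat \<Rightarrow> nat \<Rightarrow> 'a set \<Rightarrow> 'a set set \<Rightarrow> bool" where
  "steiner_system k w W B \<longleftrightarrow>
     finite W \<and> card W = w \<and>
     (\<forall>b\<in>B. b \<subseteq> W \<and> card b = k) \<and>
     (\<forall>x\<in>W. \<forall>y\<in>W. x \<noteq> y \<longrightarrow> (\<exists>!b. b \<in> B \<and> x \<in> b \<and> y \<in> b))"

definition partial_linear_space :: "'a set \<Rightarrow> 'a set set \<Rightarrow> bool" where
  "partial_linear_space P L \<longleftrightarrow>
     (\<forall>l\<in>L. l \<subseteq> P) \<and>
     (\<forall>x\<in>P. \<forall>y\<in>P. x \<noteq> y \<longrightarrow>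
        (\<forall>l\<in>L. \<forall>m\<in>L. x \<in> l \<and> y \<in> l \<and> x \<in> m \<and> y \<in> m \<longrightarrow> l = m))"

definition collinear_in :: "'a set set \<Rightarrow> 'a \<Rightarrow> 'a \<Rightarrow> bool" where
  "collinear_in L x y \<longleftrightarrow> (\<exists>l\<in>L. x \<in> l \<and> y \<in> l)"

definition noncollinear_points :: "'a set \<Rightarrow> 'a set set \<Rightarrow> 'a \<Rightarrow> 'a set" where
  "noncollinear_points P L x = {y \<in> P. y \<noteq> x \<and> \<not> collinear_in L x y}"

(* Finiteness of the set of lines through x is explicit because card is 0 on infinite sets. *)
definition gen_pentagonal_geometry ::
    "nat \<Rightarrow> nat \<Rightarrow> nat \<Rightarrow> 'a set \<Rightarrow> 'a set set \<Rightarrow> bool" where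
  "gen_pentagonal_geometry k r w P L \<longleftrightarrow>
     2 \<le> k \<and> k \<le> w \<and> P \<noteq> {} \<and> partial_linear_space P L \<and>
     (\<forall>l\<in>L. card l = k) \<and>
     (\<forall>x\<in>P. finite {l\<in>L. x \<in> l} \<and> card {l\<in>L. x \<in> l} = r) \<and>
     (\<forall>x\<in>P. \<exists>B\<subseteq>L. steiner_system k w (noncollinear_points P L x) B)"

(* An undirected edge is represented by its two opposite arcs. *)
definition deficiency_graph :: "'a set \<Rightarrow> 'a set set \<Rightarrow> 'a pair_pre_digraph" where
  "deficiency_graph P L =
     \<lparr> pverts = P, parcs = {(x, y). x \<in> P \<and> y \<in> P \<and> x \<noteq> y \<and> \<not> collinear_in L x y} \<rparr>"

(* Meant for simple undirected graphs, i.e. loop-free symmetric G.  There cycle also holds of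
   the closed walk u, v, u along the two arcs of a single edge; the bound 3 excludes these.
   Acyclic graphs have girth infinity. *)
definition girth :: "'a pair_pre_digraph \<Rightarrow> enat" where
  "girth G = (INF p \<in> {p. pre_digraph.cycle (with_proj G) p \<and> 3 \<le> length p}. enat (length p))"

end

theory Submission
  imports Defs
begin

text \<open>
  In a graph of girth 5 two vertices have at most one common neighbour, and neighbours of a common
  vertex are not adjacent.  So in a 13-regular graph of girth 5 the complete graphs on the
  neighbourhoods are edge-disjoint, and their edges are the pairs of vertices at distance 2.  Each
  neighbourhood can be made into a projective plane of order 3, which is a Steiner system
  \<open>S(2,4,13)\<close>.  To obtain a pentagonal geometry with the given deficiency graph it therefore suffices
  to split the pairs at distance at least 3 into quadruples; these quadruples are the lines that lie
  in none of the planes (\<open>pentagonal_geometry_from_cliques\<close>).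

  A geometry with \<open>r\<close> lines on each point has \<open>v = 3 r + 14\<close> points.  Here the points are the residues
  modulo the even number \<open>v\<close>, and everything is invariant under the translations by even residues.
  Two orbits are used because a cyclic group acting regularly does not work: two generators \<open>a\<close> and
  \<open>b\<close> with \<open>b\<close> different from \<open>a\<close> and \<open>-a\<close> give the 4-cycle \<open>0, a, a + b, b\<close>.  Up to translation, an
  ordered pair of distinct points is given by a difference and a parity, and all the requirements
  turn into one: the neighbourhoods of 0 and of 1, the base quadruples and the arcs of the graph
  must together represent each (difference, parity) exactly once.  This is the notion
  \<open>difference_family\<close>.  Exactness for pairs in neighbourhoods excludes cycles of length 3 and 4;
  the 5-cycles and the connectedness are built into the shape of the graph
  (\<open>pentagonal_geometry_of_family\<close>).  What is left is one explicit difference family for each \<open>r\<close>,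
  which is verified by computation.
\<close>


section \<open>Girth 5 and connectedness of symmetric graphs\<close>

lemma girth_eq_5I:
  fixes G :: "'a pair_pre_digraph"
  assumes wf: "\<And>x y. (x, y) \<in> parcs G \<Longrightarrow> x \<in> pverts G \<and> y \<in> pverts G"
    and tri: "\<And>x y z. (x, y) \<in> parcs G \<Longrightarrow> (y, z) \<in> parcs G \<Longrightarrow> (z, x) \<notin> parcs G"
    and quad: "\<And>x y z w. (x, y) \<in> parcs G \<Longrightarrow> (y, z) \<in> parcs G \<Longrightarrow> (z, w) \<in> parcs G \<Longrightarrow>
       (w, x) \<in> parcs G \<Longrightarrow> x = z \<or> y = w"
    and pent: "(a, b) \<in> parcs G" "(b, c) \<in> parcs G" "(c, d) \<in> parcs G" "(d, e) \<in> parcs G"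
      "(e, a) \<in> parcs G" "distinct [a, b, c, d, e]"
  shows "girth G = 5"
proof -
  let ?C = "{p. pre_digraph.cycle (with_proj G) p \<and> 3 \<le> length p}"
  note walk = pre_digraph.cycle_def pre_digraph.awalk_def pre_digraph.cas.simps
    pre_digraph.awalk_verts.simps
  have lower: "5 \<le> length p" if p: "pre_digraph.cycle (with_proj G) p" "3 \<le> length p" for p
  proof (rule ccontr)
    assume "\<not> 5 \<le> length p"
    then consider "length p = 3" | "length p = 4" using p by linarith
    then show False
    proof cases
      case 1
      then obtain x1 y1 x2 y2 x3 y3 where e: "p = [(x1, y1), (x2, y2), (x3, y3)]"
        by (auto simp: length_Suc_conv numeral_eq_Suc)
      have "(x1, y1) \<in> parcs G" "(y1, y2) \<in> parcs G" "(y2, x1) \<in> parcs G"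
        using p unfolding e walk by auto
      then show ?thesis using tri by blast
    next
      case 2
      then obtain x1 y1 x2 y2 x3 y3 x4 y4 where e: "p = [(x1, y1), (x2, y2), (x3, y3), (x4, y4)]"
        by (auto simp: length_Suc_conv numeral_eq_Suc)
      \<comment> \<open>Distinctness of the visited vertices says that neither diagonal of the 4-cycle collapses.\<close>
      have "(x1, y1) \<in> parcs G" "(y1, y2) \<in> parcs G" "(y2, y3) \<in> parcs G" "(y3, x1) \<in> parcs G"
        "x1 \<noteq> y2" "y1 \<noteq> y3"
        using p unfolding e walk by auto
      then show ?thesis using quad by blast
    qed
  qed
  have "pre_digraph.cycle (with_proj G) [(a, b), (b, c), (c, d), (d, e), (e, a)]"
    unfolding walk using pent wf by (intro exI[of _ a]) auto
  then have "[(a, b), (b, c), (c, d), (d, e), (e, a)] \<in> ?C" by simp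
  then have "girth G \<le> enat (length [(a, b), (b, c), (c, d), (d, e), (e, a)])"
    unfolding girth_def by (rule INF_lower)
  then have "girth G \<le> enat 5" by (simp add: eval_nat_numeral)
  moreover have "5 \<le> girth G" unfolding girth_def
    using lower by (intro INF_greatest) (auto simp: numeral_eq_enat)
  ultimately show ?thesis by (simp add: numeral_eq_enat)
qed

lemma connected_symmetricI:
  fixes G :: "'a pair_pre_digraph"
  assumes wf: "\<And>x y. (x, y) \<in> parcs G \<Longrightarrow> x \<in> pverts G \<and> y \<in> pverts G"
    and sym: "\<And>x y. (x, y) \<in> parcs G \<Longrightarrow> (y, x) \<in> parcs G"
    and root: "a \<in> pverts G" "\<And>x. x \<in> pverts G \<Longrightarrow> a \<rightarrow>\<^sup>*\<^bsub>with_proj G\<^esub> x"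
  shows "Digraph_Component.connected (with_proj G)"
proof -
  interpret wf_digraph "with_proj G" using wf by unfold_locales auto
  have s: "symmetric (with_proj G)" using sym by (auto simp: symmetric_def intro: symI)
  have "x \<rightarrow>\<^sup>*\<^bsub>with_proj G\<^esub> y" if "x \<in> pverts G" "y \<in> pverts G" for x y
    using that root symmetric_reachable[OF s root(2)[OF that(1)]] reachable_trans by blast
  then have "strongly_connected (with_proj G)"
    using root(1) by (auto simp: strongly_connected_def)
  then show ?thesis
    using s by (simp add: connected_def strongly_connected_def reachable_mk_symmetric_eq)
qed

section \<open>From neighbourhood cliques to a pentagonal geometry\<close>

text \<open>The cyclic model of the projective plane of order 3: its lines are the translates of the
  perfect difference set \<open>{0, 1, 3, 9}\<close> modulo 13.\<close>
definition pg_line :: "int \<Rightarrow> int list" where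
  "pg_line i = map (\<lambda>d. (i + d) mod 13) [0, 1, 3, 9]"

lemma pg_line_card:
  "\<forall>i\<in>set [0..12]. distinct (pg_line i) \<and> list_all (\<lambda>x. 0 \<le> x \<and> x \<le> 12) (pg_line i)"
  by code_simp

lemma pg_line_unique:
  "\<forall>x\<in>set [0..12]. \<forall>y\<in>set [0..12]. x \<noteq> y \<longrightarrow>
     length (filter (\<lambda>i. x \<in> set (pg_line i) \<and> y \<in> set (pg_line i)) [0..12]) = 1"
  by code_simp

lemma projective_plane_of_order_3_exists:
  assumes "card W = 13"
  shows "\<exists>B. steiner_system 4 13 W B"
proof -
  have fin: "finite W" using assms card.infinite by fastforce
  let ?I = "{0..12::int}"
  obtain h where h: "bij_betw h ?I W"
    using finite_same_card_bij[of ?I W] fin assms by auto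
  define line where "line i = h ` set (pg_line i)" for i
  have pg: "set (pg_line i) \<subseteq> ?I" "distinct (pg_line i)" if "i \<in> ?I" for i
    using bspec[OF pg_line_card[unfolded set_upto] that] by (auto simp only: list_all_iff atLeastAtMost_iff)
  have "card (line i) = 4" if "i \<in> ?I" for i
  proof -
    have "card (set (pg_line i)) = 4" using distinct_card[OF pg(2)[OF that]] by (simp add: pg_line_def)
    then show ?thesis unfolding line_def
      using card_image[OF inj_on_subset[OF bij_betw_imp_inj_on[OF h] pg(1)[OF that]]] by simp
  qed
  moreover have "line i \<subseteq> W" if "i \<in> ?I" for i
    using pg(1)[OF that] bij_betw_imp_surj_on[OF h] unfolding line_def by blast
  moreover have "\<exists>!b. b \<in> line ` ?I \<and> x \<in> b \<and> y \<in> b" if xy: "x \<in> W" "y \<in> W" "x \<noteq> y" for x y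
  proof -
    obtain u v where uv: "u \<in> ?I" "v \<in> ?I" "x = h u" "y = h v"
      using xy bij_betw_imp_surj_on[OF h] by blast
    have mem: "h w \<in> line i \<longleftrightarrow> w \<in> set (pg_line i)" if "i \<in> ?I" "w \<in> ?I" for i w
      unfolding line_def using inj_on_image_mem_iff[OF bij_betw_imp_inj_on[OF h]] pg(1) that by blast
    have "length (filter (\<lambda>i. u \<in> set (pg_line i) \<and> v \<in> set (pg_line i)) [0..12]) = 1"
      using pg_line_unique[unfolded set_upto, rule_format, of u v] uv xy(3) by blast
    then obtain i where "filter (\<lambda>i. u \<in> set (pg_line i) \<and> v \<in> set (pg_line i)) [0..12] = [i]"
      by (auto simp: length_Suc_conv)
    then have "set (filter (\<lambda>i. u \<in> set (pg_line i) \<and> v \<in> set (pg_line i)) [0..12]) = {i}"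
      by simp
    then have i: "{i \<in> ?I. u \<in> set (pg_line i) \<and> v \<in> set (pg_line i)} = {i}"
      by auto
    show ?thesis
    proof (rule ex1I[of _ "line i"])
      show "line i \<in> line ` ?I \<and> x \<in> line i \<and> y \<in> line i" using i mem uv by blast
      show "b = line i" if b: "b \<in> line ` ?I \<and> x \<in> b \<and> y \<in> b" for b
      proof -
        obtain j where j: "j \<in> ?I" "b = line j" using b by blast
        then have "u \<in> set (pg_line j)" "v \<in> set (pg_line j)"
          using b mem[OF j(1)] uv by auto
        then have "j \<in> {i \<in> ?I. u \<in> set (pg_line i) \<and> v \<in> set (pg_line i)}" using j(1) by blast
        then have "j = i" unfolding i by simp
        then show ?thesis using j(2) by simp
      qed
    qed
  qed
  ultimately have "steiner_system 4 13 W (line ` ?I)"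
    using fin assms by (auto simp: steiner_system_def)
  then show ?thesis by blast
qed

text \<open>The vertex neighbourhoods \<open>N x\<close> are treated as if they were lines with 13 points.  If they and
  the quadruples in \<open>Q\<close> together cover every pair that is not deficient once, and no deficient
  pair, then replacing each neighbourhood by a projective plane of order 3 on its points leaves the
  covering property intact.  So the result is a partial linear space whose non-collinear pairs are
  the deficient ones, and the plane on \<open>N x\<close> is the Steiner system that is asked for at \<open>x\<close>.  The
  replication number comes from counting: the lines on \<open>x\<close> partition the \<open>3 r\<close> points collinear
  with \<open>x\<close> into triples.\<close>
theorem pentagonal_geometry_from_cliques:
  fixes P :: "'a set" and N :: "'a \<Rightarrow> 'a set" and Q :: "'a set set"
  assumes cardP: "card P = 3 * r + 14"
    and N: "\<And>x. x \<in> P \<Longrightarrow> N x \<subseteq> P" "\<And>x. x \<in> P \<Longrightarrow> card (N x) = 13" "\<And>x. x \<in> P \<Longrightarrow> x \<notin> N x"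
    and Q: "\<And>q. q \<in> Q \<Longrightarrow> q \<subseteq> P" "\<And>q. q \<in> Q \<Longrightarrow> card q = 4"
    and cover: "\<And>x y. x \<in> P \<Longrightarrow> y \<in> P \<Longrightarrow> x \<noteq> y \<Longrightarrow> y \<notin> N x \<Longrightarrow>
      \<exists>C \<in> N ` P \<union> Q. x \<in> C \<and> y \<in> C"
    and sep: "\<And>C x y. C \<in> N ` P \<union> Q \<Longrightarrow> x \<in> C \<Longrightarrow> y \<in> C \<Longrightarrow> y \<notin> N x"
    and uniq: "\<And>C C' x y. C \<in> N ` P \<union> Q \<Longrightarrow> C' \<in> N ` P \<union> Q \<Longrightarrow> x \<noteq> y \<Longrightarrow>
      x \<in> C \<Longrightarrow> y \<in> C \<Longrightarrow> x \<in> C' \<Longrightarrow> y \<in> C' \<Longrightarrow> C = C'"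
  shows "\<exists>L. gen_pentagonal_geometry 4 r 13 P L \<and>
    (\<forall>x\<in>P. \<forall>y\<in>P. x \<noteq> y \<longrightarrow> (collinear_in L x y \<longleftrightarrow> y \<notin> N x))"
proof -
  have finP: "finite P" using cardP card.infinite by fastforce
  \<comment> \<open>The plane is chosen as a function of the point set, so that equal neighbourhoods carry equal planes.\<close>
  define plane where "plane C = (SOME B. steiner_system 4 13 C B)" for C :: "'a set"
  have plane: "steiner_system 4 13 (N x) (plane (N x))" if "x \<in> P" for x
    unfolding plane_def using someI_ex[OF projective_plane_of_order_3_exists[OF N(2)[OF that]]] .
  have plane_line: "\<exists>!b. b \<in> plane (N z) \<and> x \<in> b \<and> y \<in> b"
    if "z \<in> P" "x \<in> N z" "y \<in> N z" "x \<noteq> y" for x y z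
    using plane[OF that(1)] that(2-4) by (simp add: steiner_system_def)
  have plane_sub: "l \<subseteq> N z" "card l = 4" if "z \<in> P" "l \<in> plane (N z)" for z l
    using plane[OF that(1)] that(2) by (auto simp: steiner_system_def)
  define L where "L = Q \<union> (\<Union>C \<in> N ` P. plane C)"
  have line: "\<exists>C \<in> N ` P \<union> Q. l \<subseteq> C \<and> (C \<in> Q \<and> l = C \<or> C \<in> N ` P \<and> l \<in> plane C)" if "l \<in> L" for l
    using that plane_sub(1) unfolding L_def by blast
  have clique_sub: "C \<subseteq> P" if "C \<in> N ` P \<union> Q" for C using that N(1) Q(1) by blast
  have line_sub: "l \<subseteq> P" if "l \<in> L" for l using line[OF that] clique_sub by blast
  have line_card: "card l = 4" if "l \<in> L" for l
    using that plane_sub(2) Q(2) unfolding L_def by blast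
  have QN: "C \<notin> Q" if "C \<in> N ` P" for C using that N(2) Q(2) by force
  have pls: "l = m" if lm: "l \<in> L" "m \<in> L" "x \<noteq> y" "x \<in> l" "y \<in> l" "x \<in> m" "y \<in> m" for l m x y
  proof -
    obtain C where C: "C \<in> N ` P \<union> Q" "l \<subseteq> C" "C \<in> Q \<and> l = C \<or> C \<in> N ` P \<and> l \<in> plane C"
      using line[OF lm(1)] by blast
    obtain C' where C': "C' \<in> N ` P \<union> Q" "m \<subseteq> C'" "C' \<in> Q \<and> m = C' \<or> C' \<in> N ` P \<and> m \<in> plane C'"
      using line[OF lm(2)] by blast
    have eq: "C' = C" using uniq[OF C'(1) C(1) lm(3)] C(2) C'(2) lm by blast
    show ?thesis
    proof (cases "C \<in> Q")
      case True
      then show ?thesis using C(3) C'(3) QN unfolding eq by blast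
    next
      case False
      then obtain z where z: "z \<in> P" "C = N z" "l \<in> plane C" "m \<in> plane C"
        using C(3) C'(3) unfolding eq by blast
      have "x \<in> N z" "y \<in> N z" using lm C(2) z(2) by blast+
      then show ?thesis using plane_line[OF z(1) _ _ lm(3)] z(2-4) lm(4-7) by blast
    qed
  qed
  have col: "collinear_in L x y \<longleftrightarrow> y \<notin> N x" if xy: "x \<in> P" "y \<in> P" "x \<noteq> y" for x y
  proof
    assume "collinear_in L x y"
    then obtain l where l: "l \<in> L" "x \<in> l" "y \<in> l" unfolding collinear_in_def by blast
    obtain C where "C \<in> N ` P \<union> Q" "l \<subseteq> C" using line[OF l(1)] by blast
    then show "y \<notin> N x" using sep l(2,3) by blast
  next
    assume "y \<notin> N x"
    then obtain C where C: "C \<in> N ` P \<union> Q" "x \<in> C" "y \<in> C" using cover xy by blast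
    then show "collinear_in L x y"
    proof (cases "C \<in> Q")
      case True
      then show ?thesis using C unfolding collinear_in_def L_def by blast
    next
      case False
      then obtain z where z: "z \<in> P" "C = N z" using C by blast
      obtain b where "b \<in> plane C" "x \<in> b" "y \<in> b"
        using plane_line[OF z(1), of x y] C xy(3) unfolding z(2) by blast
      then show ?thesis using z unfolding collinear_in_def L_def by blast
    qed
  qed
  have nonc: "noncollinear_points P L x = N x" if "x \<in> P" for x
    unfolding noncollinear_points_def using col[OF that] N(1,3)[OF that] by blast
  have finL: "finite L" using line_sub finP by (meson Pow_iff finite_Pow_iff finite_subset subsetI)
  have count: "card {l \<in> L. x \<in> l} = r" if x: "x \<in> P" for x
  proof -
    let ?S = "{l \<in> L. x \<in> l}"
    have finS: "finite ?S" using finL by simp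
    have "card (\<Union>l\<in>?S. l - {x}) = (\<Sum>l\<in>?S. card (l - {x}))"
    proof (rule card_UN_disjoint[OF finS])
      show "\<forall>l\<in>?S. finite (l - {x})" using line_sub finP finite_subset by blast
      show "\<forall>l\<in>?S. \<forall>m\<in>?S. l \<noteq> m \<longrightarrow> (l - {x}) \<inter> (m - {x}) = {}"
        using pls by blast
    qed
    also have "\<dots> = (\<Sum>l\<in>?S. 3)" using line_card by (intro sum.cong) auto
    finally have "card (\<Union>l\<in>?S. l - {x}) = 3 * card ?S" by simp
    moreover have "(\<Union>l\<in>?S. l - {x}) = P - insert x (N x)"
      using col[OF x] line_sub N(3)[OF x] unfolding collinear_in_def by blast
    moreover have "card (P - insert x (N x)) = card P - 14"
      using x N[OF x] finP finite_subset[OF N(1)[OF x] finP] by (subst card_Diff_subset) auto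
    ultimately show ?thesis using cardP by simp
  qed
  have "gen_pentagonal_geometry 4 r 13 P L"
    unfolding gen_pentagonal_geometry_def
  proof (intro conjI ballI)
    show "P \<noteq> {}" using cardP by auto
    show "partial_linear_space P L"
      unfolding partial_linear_space_def using pls line_sub by blast
    show "finite {l \<in> L. x \<in> l}" for x using finL by simp
    show "\<exists>B\<subseteq>L. steiner_system 4 13 (noncollinear_points P L x) B" if "x \<in> P" for x
    proof (intro exI[of _ "plane (N x)"] conjI)
      show "plane (N x) \<subseteq> L" using that unfolding L_def by blast
      show "steiner_system 4 13 (noncollinear_points P L x) (plane (N x))"
        using plane[OF that] nonc[OF that] by simp
    qed
  qed (use line_card count in auto)
  then show ?thesis using col by blast
qed

section \<open>Arrangements of an interval of integers\<close>

text \<open>The families below are verified by checking that lists of up to 1010 integers are arrangements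
  of intervals.  The check proceeds by binary digits, least significant first: a binary numeral loses
  its last digit in one rewrite step, whereas an arithmetic comparison costs many, and testing
  distinctness directly would need quadratically many comparisons.\<close>
fun bit0s :: "num list \<Rightarrow> num list" where
  "bit0s [] = []"
| "bit0s (num.One # xs) = bit0s xs"
| "bit0s (num.Bit0 n # xs) = n # bit0s xs"
| "bit0s (num.Bit1 n # xs) = bit0s xs"

fun bit1s :: "num list \<Rightarrow> num list" where
  "bit1s [] = []"
| "bit1s (num.One # xs) = bit1s xs"
| "bit1s (num.Bit0 n # xs) = bit1s xs"
| "bit1s (num.Bit1 n # xs) = n # bit1s xs"

fun ones :: "num list \<Rightarrow> num list" where
  "ones [] = []"
| "ones (num.One # xs) = num.One # ones xs"
| "ones (num.Bit0 n # xs) = ones xs"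
| "ones (num.Bit1 n # xs) = ones xs"

lemma set_bit0s: "n \<in> set (bit0s xs) \<longleftrightarrow> num.Bit0 n \<in> set xs"
  by (induction xs rule: bit0s.induct) auto

lemma set_bit1s: "n \<in> set (bit1s xs) \<longleftrightarrow> num.Bit1 n \<in> set xs"
  by (induction xs rule: bit1s.induct) auto

lemma set_ones: "n \<in> set (ones xs) \<longleftrightarrow> n = num.One \<and> num.One \<in> set xs"
  by (induction xs rule: ones.induct) auto

lemma distinct_by_last_bit:
  "distinct (ones xs) \<Longrightarrow> distinct (bit0s xs) \<Longrightarrow> distinct (bit1s xs) \<Longrightarrow> distinct xs"
proof (induction xs)
  case (Cons x xs)
  then show ?case by (cases x) (auto simp: set_bit0s set_bit1s set_ones)
qed simp

text \<open>\<open>xs\<close> is an arrangement of \<open>1, ..., m - 1\<close> iff 1 occurs once, the halves of its even members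
  arrange the positive \<open>k\<close> with \<open>2 k < m\<close>, and those of its other odd members the positive \<open>k\<close> with
  \<open>2 k + 1 < m\<close>.\<close>
function radix_tiles :: "int \<Rightarrow> num list \<Rightarrow> bool" where
  "radix_tiles m xs =
     (if m \<le> 1 then xs = []
      else ones xs = [num.One] \<and>
        radix_tiles ((m + 1) div 2) (bit0s xs) \<and> radix_tiles (m div 2) (bit1s xs))"
  by auto
termination by (relation "measure (\<lambda>(m, xs). nat m)") auto

declare radix_tiles.simps [simp del]

definition num_of_int :: "int \<Rightarrow> num" where
  "num_of_int k = num_of_nat (nat k)"

text \<open>As a code equation this makes the conversion a single step on positive numerals.\<close>
lemma num_of_int_numeral [code]: "num_of_int (Int.Pos n) = n"
  by (simp add: num_of_int_def)

lemma numeral_num_of_int: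
  assumes "0 < z"
  shows "numeral (num_of_int z) = z"
proof -
  have "numeral (num_of_nat (nat z)) = nat z" using assms by (simp add: numeral_num_of_nat)
  then have "int (numeral (num_of_nat (nat z))) = z" using assms by simp
  then show ?thesis by (simp add: num_of_int_def)
qed

lemma radix_tiles_sound:
  "radix_tiles m xs \<Longrightarrow> distinct xs \<and> numeral ` set xs = {1..<m}"
proof (induction m xs rule: radix_tiles.induct)
  case (1 m xs)
  show ?case
  proof (cases "m \<le> 1")
    case True
    then show ?thesis using "1.prems" by (subst (asm) radix_tiles.simps) simp
  next
    case False
    have o: "ones xs = [num.One]" and e: "radix_tiles ((m + 1) div 2) (bit0s xs)"
      "radix_tiles (m div 2) (bit1s xs)"
      using "1.prems" False by (subst (asm) radix_tiles.simps, simp)+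
    have i0: "distinct (bit0s xs)" "numeral ` set (bit0s xs) = {1..<(m + 1) div 2}"
      using "1.IH"(1)[OF False e(1)] by auto
    have i1: "distinct (bit1s xs)" "numeral ` set (bit1s xs) = {1..<m div 2}"
      using "1.IH"(2)[OF False e(2)] by auto
    have double0: "2 * w \<in> {1..<m}" if "w \<in> {1..<(m + 1) div 2}" for w using that by auto
    have double1: "2 * w + 1 \<in> {1..<m}" if "w \<in> {1..<m div 2}" for w using that by auto
    have half0: "w \<in> {1..<(m + 1) div 2}" if "2 * w \<in> {1..<m}" for w using that by auto
    have half1: "w \<in> {1..<m div 2}" if "2 * w + 1 \<in> {1..<m}" "w \<noteq> 0" for w using that by auto
    have "distinct xs" using distinct_by_last_bit[of xs] o i0(1) i1(1) by simp
    moreover have "numeral n \<in> {1..<m}" if n: "n \<in> set xs" for n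
    proof (cases n)
      case One
      then show ?thesis using False by simp
    next
      case (Bit0 k)
      then have "numeral k \<in> {1..<(m + 1) div 2}" using n i0(2) set_bit0s by blast
      then have "2 * numeral k \<in> {1..<m}" by (rule double0)
      then show ?thesis using Bit0 by simp
    next
      case (Bit1 k)
      then have "numeral k \<in> {1..<m div 2}" using n i1(2) set_bit1s by blast
      then have "2 * numeral k + 1 \<in> {1..<m}" by (rule double1)
      then show ?thesis using Bit1 by simp
    qed
    moreover have "z \<in> numeral ` set xs" if z: "z \<in> {1..<m}" for z
    proof -
      obtain n where n: "z = numeral n" using z numeral_num_of_int[of z] by auto
      have "n \<in> set xs"
      proof (cases n)
        case One
        then show ?thesis using o set_ones[of num.One xs] by simp
      next
        case (Bit0 k)
        then have "(numeral k :: int) \<in> numeral ` set (bit0s xs)"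
          unfolding i0(2) using z n by (intro half0) simp
        then show ?thesis using Bit0 set_bit0s by auto
      next
        case (Bit1 k)
        then have "(numeral k :: int) \<in> numeral ` set (bit1s xs)"
          unfolding i1(2) using z n by (intro half1) simp_all
        then show ?thesis using Bit1 set_bit1s by auto
      qed
      then show ?thesis using n by blast
    qed
    ultimately show ?thesis by blast
  qed
qed

definition tiles :: "int \<Rightarrow> int list \<Rightarrow> bool" where
  "tiles m xs \<longleftrightarrow> list_all (\<lambda>x. 0 < x) xs \<and> radix_tiles m (map num_of_int xs)"

lemma tiles_permutation:
  assumes "tiles m xs"
  shows "distinct xs" and "set xs = {1..<m}"
proof -
  have pos: "numeral (num_of_int x) = x" if "x \<in> set xs" for x
    using assms that by (auto simp: tiles_def list_all_iff numeral_num_of_int)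
  have "distinct (map num_of_int xs)" "numeral ` num_of_int ` set xs = {1..<m}"
    using assms radix_tiles_sound[of m "map num_of_int xs"] by (auto simp: tiles_def)
  moreover have "numeral ` num_of_int ` set xs = set xs"
    using pos by (force simp: image_image)
  ultimately show "distinct xs" "set xs = {1..<m}" by (auto simp: distinct_map)
qed

section \<open>Geometries invariant under even translations\<close>

text \<open>The deficiency graph on \<open>\<int>\<^sub>v\<close>: an even \<open>x\<close> is adjacent to \<open>x + s\<close> for \<open>s\<close> in \<open>2, -2, E\<close> and an odd
  \<open>x\<close> for \<open>s\<close> in \<open>4, -4, -E\<close>, where \<open>E\<close> consists of odd residues.  If both parities used the same
  step \<open>d\<close>, then \<open>0, e, e + d, d\<close> would be a 4-cycle; with the steps 2 and 4 it is replaced by the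
  5-cycle \<open>0, e, e + 4, 4, 2\<close>.\<close>
definition shifts :: "int list \<Rightarrow> int \<Rightarrow> int list" where
  "shifts E x = (if even x then 2 # -2 # E else 4 # -4 # map uminus E)"

text \<open>An ordered pair of residues is determined up to even translations by its difference and the
  parity of its first entry.  Both are packed into one integer in such a way that the pairs of distinct
  residues receive precisely the keys from 1 to \<open>2 * v - 2\<close>.\<close>
definition key :: "int \<Rightarrow> int \<Rightarrow> int \<Rightarrow> int" where
  "key v x y = 2 * ((y - x) mod v) + x mod 2 - 1"

text \<open>Differences of entries are usually within \<open>v\<close> of zero, so that reducing them takes one addition in
  place of a division.\<close>
lemma key_code [code]:
  "key v x y = 2 * (let d = y - x in
     if 0 \<le> d \<and> d < v then d else if d < 0 \<and> - v \<le> d then d + v else d mod v) + x mod 2 - 1"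
proof -
  have "d mod v = d + v" if "d < 0" "- v \<le> d" for d :: int
    using mod_pos_pos_trivial[of "d + v" v] that by simp
  then show ?thesis by (auto simp: key_def Let_def)
qed

text \<open>The neighbourhoods of the vertices 0 and 1, which represent the two orbits, and the quadruples.\<close>
definition base_cliques :: "int list \<Rightarrow> int list list \<Rightarrow> int list list" where
  "base_cliques E Bs = map (\<lambda>x. map ((+) x) (shifts E x)) [0, 1] @ Bs"

definition clique_pairs :: "int list list \<Rightarrow> (int list \<times> int \<times> int) list" where
  "clique_pairs Cs = [(C, a, c). C \<leftarrow> Cs, a \<leftarrow> C, c \<leftarrow> C, a \<noteq> c]"

definition clique_keys :: "int \<Rightarrow> int list \<Rightarrow> int list list \<Rightarrow> int list" where
  "clique_keys v E Bs = map (\<lambda>(C, a, c). key v a c) (clique_pairs (base_cliques E Bs))"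

definition deficiency_keys :: "int \<Rightarrow> int list \<Rightarrow> int list" where
  "deficiency_keys v E = [key v x (x + s). x \<leftarrow> [0, 1], s \<leftarrow> shifts E x]"

text \<open>Every orbit of ordered pairs of distinct residues belongs to precisely one place: an ordered pair
  inside a base clique, or an arc of the deficiency graph.\<close>
definition difference_family :: "int \<Rightarrow> int list \<Rightarrow> int list list \<Rightarrow> bool" where
  "difference_family v E Bs \<longleftrightarrow>
     even v \<and> 4 < v \<and> length E = 11 \<and> list_all odd E \<and>
     list_all (\<lambda>B. length B = 4 \<and> distinct B) Bs \<and>
     tiles (2 * v - 1) (clique_keys v E Bs @ deficiency_keys v E)"

locale cyclic_family =
  fixes v :: int and E :: "int list" and Bs :: "int list list"
  assumes fam: "difference_family v E Bs"
begin

definition pt :: "int \<Rightarrow> nat" where "pt a = nat (a mod v)"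

definition nbrs :: "nat \<Rightarrow> nat set" where
  "nbrs x = (\<lambda>s. pt (int x + s)) ` set (shifts E (int x))"

definition translate :: "int \<Rightarrow> int list \<Rightarrow> nat set" where
  "translate t C = (\<lambda>a. pt (a + t)) ` set C"

definition points :: "nat set" where "points = {..<nat v}"

definition quads :: "nat set set" where
  "quads = {translate t B | t B. even t \<and> B \<in> set Bs}"

lemma even_v: "even v" and v_gt: "4 < v" and len_E: "length E = 11"
  and odd_E: "e \<in> set E \<Longrightarrow> odd e"
  and Bs: "B \<in> set Bs \<Longrightarrow> length B = 4 \<and> distinct B"
  using fam by (auto simp: difference_family_def list_all_iff)

lemma keys_perm:
  shows "distinct (clique_keys v E Bs @ deficiency_keys v E)"
    and "set (clique_keys v E Bs) \<union> set (deficiency_keys v E) = {1..<2 * v - 1}"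
  using tiles_permutation[of "2 * v - 1" "clique_keys v E Bs @ deficiency_keys v E"] fam
  by (simp_all add: difference_family_def)

lemma pt_eq_iff: "pt a = pt b \<longleftrightarrow> a mod v = b mod v"
  unfolding pt_def using v_gt by (metis nat_eq_iff2 pos_mod_sign order.strict_trans zero_less_numeral)

lemma pt_add_cancel: "pt (a + s) = pt (a + t) \<longleftrightarrow> s mod v = t mod v"
  by (simp add: pt_eq_iff mod_eq_dvd_iff)

lemma pt_in [simp]: "pt a \<in> points"
  unfolding pt_def points_def using v_gt by (simp add: nat_less_eq_zless)

lemma int_pt [simp]: "int (pt a) = a mod v"
  unfolding pt_def using v_gt by simp

lemma pt_int: "x \<in> points \<Longrightarrow> pt (int x) = x"
  unfolding pt_def points_def by simp

lemma even_mod_v [simp]: "even (a mod v) \<longleftrightarrow> even a"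
  using even_v by (simp add: dvd_mod_iff)

lemma shifts_cong: "even x \<longleftrightarrow> even y \<Longrightarrow> shifts E x = shifts E y"
  by (simp add: shifts_def)

lemma key_eq_iff:
  "key v a c = key v a' c' \<longleftrightarrow> (c - a) mod v = (c' - a') mod v \<and> (even a \<longleftrightarrow> even a')"
proof -
  have "2 * p + i mod 2 - 1 = 2 * q + j mod 2 - 1 \<longleftrightarrow> p = q \<and> (even i \<longleftrightarrow> even j)" for p q i j :: int
    by presburger
  then show ?thesis unfolding key_def .
qed

lemma key_pos: "1 \<le> key v a c \<longleftrightarrow> a mod v \<noteq> c mod v"
proof -
  have "0 \<le> (c - a) mod v" using v_gt by simp
  moreover have "(c - a) mod v = 0 \<longleftrightarrow> a mod v = c mod v"
    by (metis mod_eq_dvd_iff mod_0_imp_dvd dvd_imp_mod_0)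
  ultimately show ?thesis unfolding key_def by (auto simp: mod2_eq_if)
qed

lemma key_less: "key v a c < 2 * v - 1"
proof -
  have "(c - a) mod v < v" using v_gt by simp
  then show ?thesis unfolding key_def by (auto simp: mod2_eq_if)
qed

lemma key_pt: "even t \<Longrightarrow> key v (int (pt (a + t))) (int (pt (c + t))) = key v a c"
  by (simp add: key_eq_iff mod_diff_eq)

lemma clique_pairs_iff:
  "(C, a, c) \<in> set (clique_pairs Cs) \<longleftrightarrow> C \<in> set Cs \<and> a \<in> set C \<and> c \<in> set C \<and> a \<noteq> c"
  unfolding clique_pairs_def by auto

lemma clique_key_mem:
  "C \<in> set (base_cliques E Bs) \<Longrightarrow> a \<in> set C \<Longrightarrow> c \<in> set C \<Longrightarrow> a \<noteq> c \<Longrightarrow>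
     key v a c \<in> set (clique_keys v E Bs)"
  unfolding clique_keys_def using clique_pairs_iff by force

text \<open>Since the arcs of the deficiency graph form whole orbits, adjacency is a matter of keys.\<close>
lemma nbrs_iff:
  assumes "x \<in> points" "y \<in> points"
  shows "y \<in> nbrs x \<longleftrightarrow> key v (int x) (int y) \<in> set (deficiency_keys v E)"
proof
  assume "y \<in> nbrs x"
  then obtain s where s: "s \<in> set (shifts E (int x))" "y = pt (int x + s)"
    unfolding nbrs_def by blast
  let ?p = "int x mod 2"
  have "s \<in> set (shifts E ?p)" using s(1) shifts_cong[of ?p "int x"] by simp
  moreover have "key v (int x) (int y) = key v ?p (?p + s)"
    unfolding s(2) by (simp add: key_eq_iff mod_diff_left_eq)
  moreover have "?p \<in> {0, 1}" by auto
  ultimately show "key v (int x) (int y) \<in> set (deficiency_keys v E)"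
    unfolding deficiency_keys_def by auto
next
  assume "key v (int x) (int y) \<in> set (deficiency_keys v E)"
  then obtain p s where s: "s \<in> set (shifts E p)" "key v (int x) (int y) = key v p (p + s)"
    unfolding deficiency_keys_def by auto
  then have eq: "(int y - int x) mod v = s mod v" and par: "even x \<longleftrightarrow> even p"
    by (auto simp: key_eq_iff)
  have "int y mod v = (int x + s) mod v"
    using eq by (metis add_diff_cancel_left' diff_add_cancel mod_add_left_eq add.commute)
  then have "y = pt (int x + s)" using pt_int[OF assms(2)] pt_eq_iff by metis
  then show "y \<in> nbrs x" unfolding nbrs_def using s(1) shifts_cong[of p "int x"] par by auto
qed

lemma translate_base_nbrs:
  assumes "even t" "x \<in> {0, 1}"
  shows "translate t (map ((+) x) (shifts E x)) = nbrs (pt (x + t))"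
proof -
  have "shifts E ((x + t) mod v) = shifts E x"
    using assms(1) by (intro shifts_cong) simp
  moreover have "pt ((x + t) mod v + s) = pt (x + s + t)" for s
    by (simp add: pt_eq_iff mod_simps add_ac)
  ultimately show ?thesis unfolding translate_def nbrs_def by (auto simp: image_image)
qed

lemma nbrs_as_translate:
  assumes "x \<in> points"
  shows "\<exists>t p. even t \<and> p \<in> {0, 1} \<and> x = pt (p + t) \<and>
    nbrs x = translate t (map ((+) p) (shifts E p))"
proof (intro exI conjI)
  let ?p = "int x mod 2" and ?t = "int x - int x mod 2"
  show t: "even ?t" by simp
  have "?p = 0 \<or> ?p = 1" by presburger
  then show p: "?p \<in> {0, 1}" by simp
  show x: "x = pt (?p + ?t)" using pt_int[OF assms] by simp
  show "nbrs x = translate ?t (map ((+) ?p) (shifts E ?p))"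
    using translate_base_nbrs[OF t p] x by simp
qed

lemma base_nbrs_mem: "p \<in> {0, 1} \<Longrightarrow> map ((+) p) (shifts E p) \<in> set (base_cliques E Bs)"
  unfolding base_cliques_def by auto

lemma cliques_eq:
  "nbrs ` points \<union> quads = {translate t C | t C. even t \<and> C \<in> set (base_cliques E Bs)}"
    (is "?L = ?R")
proof -
  have "nbrs x \<in> ?R" if "x \<in> points" for x
    using nbrs_as_translate[OF that] base_nbrs_mem by blast
  moreover have "quads \<subseteq> ?R" unfolding quads_def base_cliques_def by auto
  moreover have "?R \<subseteq> ?L"
  proof -
    have "translate t C \<in> ?L" if t: "even t" "C \<in> set (base_cliques E Bs)" for t C
    proof (cases "C \<in> set Bs")
      case True
      then show ?thesis using t unfolding quads_def by blast
    next
      case False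
      then obtain x where "x \<in> {0, 1}" "C = map ((+) x) (shifts E x)"
        using t(2) unfolding base_cliques_def by auto
      then show ?thesis using translate_base_nbrs[OF t(1)] by simp
    qed
    then show ?thesis by blast
  qed
  ultimately show ?thesis by blast
qed

lemma translate_pairE:
  assumes "even t" "x \<in> translate t C" "y \<in> translate t C" "x \<noteq> y"
  obtains a c where "a \<in> set C" "c \<in> set C" "a \<noteq> c" "x = pt (a + t)" "y = pt (c + t)"
    "key v (int x) (int y) = key v a c"
  using assms key_pt unfolding translate_def by blast

text \<open>The key of a pair reveals the base clique and the two entries of it from which the pair arises,
  hence also the translation.\<close>
lemma translate_unique:
  assumes t: "even t" "C \<in> set (base_cliques E Bs)" "even t'" "C' \<in> set (base_cliques E Bs)"
    and xy: "x \<noteq> y" "x \<in> translate t C" "y \<in> translate t C" "x \<in> translate t' C'" "y \<in> translate t' C'"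
  shows "C = C'" and "t mod v = t' mod v"
proof -
  obtain a c where a: "a \<in> set C" "c \<in> set C" "a \<noteq> c" "x = pt (a + t)"
    "key v (int x) (int y) = key v a c"
    using translate_pairE[OF t(1) xy(2,3,1)] by metis
  obtain a' c' where a': "a' \<in> set C'" "c' \<in> set C'" "a' \<noteq> c'" "x = pt (a' + t')"
    "key v (int x) (int y) = key v a' c'"
    using translate_pairE[OF t(3) xy(4,5,1)] by metis
  have inj: "inj_on (\<lambda>(C, a, c). key v a c) (set (clique_pairs (base_cliques E Bs)))"
    using keys_perm(1) unfolding clique_keys_def by (simp add: distinct_map)
  have mem: "(C, a, c) \<in> set (clique_pairs (base_cliques E Bs))"
    "(C', a', c') \<in> set (clique_pairs (base_cliques E Bs))"
    using a a' t clique_pairs_iff by blast+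
  have "(C, a, c) = (C', a', c')" using inj_on_eq_iff[OF inj mem] a(5) a'(5) by simp
  then show "C = C'" and "t mod v = t' mod v"
    using a(4) a'(4) by (auto simp: pt_add_cancel)
qed

lemma translate_cong: "t mod v = t' mod v \<Longrightarrow> translate t C = translate t' C"
  unfolding translate_def by (intro image_cong refl) (simp add: pt_add_cancel)

lemma translate_sub: "translate t C \<subseteq> points" and nbrs_sub: "nbrs x \<subseteq> points"
  unfolding translate_def nbrs_def by auto

lemma quads_sub: "q \<in> quads \<Longrightarrow> q \<subseteq> points"
  using translate_sub unfolding quads_def by blast

lemma clique_sep:
  assumes "K \<in> nbrs ` points \<union> quads" "x \<in> K" "y \<in> K"
  shows "y \<notin> nbrs x"
proof
  assume nb: "y \<in> nbrs x"
  obtain t C where K: "K = translate t C" "even t" "C \<in> set (base_cliques E Bs)"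
    using assms(1) unfolding cliques_eq by blast
  have xy: "x \<in> points" "y \<in> points" using assms K translate_sub by blast+
  then have k: "key v (int x) (int y) \<in> set (deficiency_keys v E)" using nb nbrs_iff by blast
  then have "1 \<le> key v (int x) (int y)" using keys_perm(2) by auto
  then have "x \<noteq> y" by (auto simp: key_pos)
  then have "key v (int x) (int y) \<in> set (clique_keys v E Bs)"
    using translate_pairE[OF K(2)] assms K clique_key_mem by metis
  then show False using k keys_perm(1) by auto
qed

lemma clique_unique:
  assumes "K \<in> nbrs ` points \<union> quads" "K' \<in> nbrs ` points \<union> quads"
    "x \<noteq> y" "x \<in> K" "y \<in> K" "x \<in> K'" "y \<in> K'"
  shows "K = K'"
proof -
  obtain t C where K: "K = translate t C" "even t" "C \<in> set (base_cliques E Bs)"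
    using assms(1) unfolding cliques_eq by blast
  obtain t' C' where K': "K' = translate t' C'" "even t'" "C' \<in> set (base_cliques E Bs)"
    using assms(2) unfolding cliques_eq by blast
  show ?thesis
    using translate_unique[OF K(2,3) K'(2,3) assms(3)] assms(4-) translate_cong unfolding K(1) K'(1)
    by metis
qed

lemma clique_cover:
  assumes xy: "x \<in> points" "y \<in> points" "x \<noteq> y" "y \<notin> nbrs x"
  shows "\<exists>K \<in> nbrs ` points \<union> quads. x \<in> K \<and> y \<in> K"
proof -
  have "int x mod v \<noteq> int y mod v" using xy pt_int pt_eq_iff by metis
  then have "key v (int x) (int y) \<in> {1..<2 * v - 1}" using key_pos key_less by auto
  then have "key v (int x) (int y) \<in> set (clique_keys v E Bs)"
    using keys_perm(2) nbrs_iff[OF xy(1,2)] xy(4) by blast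
  then obtain C a c where C: "C \<in> set (base_cliques E Bs)" "a \<in> set C" "c \<in> set C"
    "key v (int x) (int y) = key v a c"
    unfolding clique_keys_def by (auto simp: clique_pairs_iff)
  define t where "t = int x - a"
  have eq: "(int y - int x) mod v = (c - a) mod v" and "even t"
    using C(4) by (auto simp: key_eq_iff t_def)
  have "x = pt (a + t)" using pt_int[OF xy(1)] by (simp add: t_def)
  moreover have "int y mod v = (c + t) mod v"
    using eq by (simp add: mod_eq_dvd_iff t_def algebra_simps)
  then have "y = pt (c + t)" using pt_int[OF xy(2)] pt_eq_iff by metis
  ultimately have "x \<in> translate t C" "y \<in> translate t C"
    using C unfolding translate_def by auto
  then show ?thesis unfolding cliques_eq using \<open>even t\<close> C(1) by blast
qed

lemma card_nbrs:
  assumes "x \<in> points"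
  shows "card (nbrs x) = 13"
proof -
  have "distinct (map (\<lambda>s. key v p (p + s)) (shifts E p))" if "p \<in> {0, 1}" for p
    using keys_perm(1) that unfolding deficiency_keys_def by auto
  then have "distinct (map (\<lambda>s. key v (int x mod 2) (int x mod 2 + s)) (shifts E (int x mod 2)))"
    by (auto simp: mod2_eq_if)
  moreover have "shifts E (int x mod 2) = shifts E (int x)" by (intro shifts_cong) simp
  ultimately have d: "distinct (shifts E (int x))"
    "inj_on (\<lambda>s. key v (int x mod 2) (int x mod 2 + s)) (set (shifts E (int x)))"
    by (simp_all add: distinct_map)
  have "inj_on (\<lambda>s. pt (int x + s)) (set (shifts E (int x)))"
  proof (rule inj_onI)
    fix s s' assume s: "s \<in> set (shifts E (int x))" "s' \<in> set (shifts E (int x))"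
      "pt (int x + s) = pt (int x + s')"
    then have "s mod v = s' mod v" by (simp add: pt_add_cancel)
    then show "s = s'" using d(2) s by (auto simp: inj_on_def key_eq_iff)
  qed
  then have "card (nbrs x) = length (shifts E (int x))"
    unfolding nbrs_def using card_image distinct_card[OF d(1)] by metis
  then show ?thesis using len_E by (simp add: shifts_def)
qed

lemma card_quad:
  assumes "q \<in> quads"
  shows "card q = 4"
proof -
  obtain t B where q: "q = translate t B" "even t" "B \<in> set Bs" using assms unfolding quads_def by blast
  have "inj_on (\<lambda>a. pt (a + t)) (set B)"
  proof (rule inj_onI, rule ccontr)
    fix a c assume a: "a \<in> set B" "c \<in> set B" "pt (a + t) = pt (c + t)" "a \<noteq> c"
    have "key v a c \<in> set (clique_keys v E Bs)"
      using a q(3) by (intro clique_key_mem[of B]) (auto simp: base_cliques_def)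
    then have "1 \<le> key v a c" using keys_perm(2) by auto
    then show False using a(3) by (auto simp: key_pos pt_eq_iff mod_eq_dvd_iff)
  qed
  then show ?thesis using Bs[OF q(3)] distinct_card unfolding q(1) translate_def
    by (metis card_image)
qed

lemma nbrs_irrefl: "x \<in> points \<Longrightarrow> x \<notin> nbrs x"
  using nbrs_iff[of x x] keys_perm(2) key_pos[of "int x" "int x"] by fastforce

lemma pt_nbrs: "s \<in> set (shifts E a) \<Longrightarrow> pt (a + s) \<in> nbrs (pt a)"
  unfolding nbrs_def using shifts_cong[of a "a mod v"]
  by (auto intro!: image_eqI[of _ _ s] simp: pt_eq_iff mod_add_left_eq)

lemma nbrs_sym:
  assumes "x \<in> points" "y \<in> nbrs x"
  shows "x \<in> nbrs y"
proof -
  obtain s where s: "s \<in> set (shifts E (int x))" "y = pt (int x + s)"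
    using assms(2) unfolding nbrs_def by blast
  have "-s \<in> set (shifts E (int x + s))"
    using s(1) odd_E by (auto simp: shifts_def split: if_splits)
  then show ?thesis using pt_nbrs[of "-s" "int x + s"] s(2) pt_int[OF assms(1)] by simp
qed

text \<open>This is the absence of 4-cycles: two common neighbours determine the neighbourhood that they
  share as a translate of a base clique, and the translation is determined modulo \<open>v\<close>.\<close>
lemma nbrs_inj:
  assumes xy: "x \<noteq> y" "x \<in> nbrs z" "y \<in> nbrs z" "x \<in> nbrs w" "y \<in> nbrs w"
    and zw: "z \<in> points" "w \<in> points"
  shows "z = w"
proof -
  obtain t p where t: "even t" "p \<in> {0, 1}" "z = pt (p + t)"
    "nbrs z = translate t (map ((+) p) (shifts E p))"
    using nbrs_as_translate[OF zw(1)] by blast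
  obtain t' p' where t': "even t'" "p' \<in> {0, 1}" "w = pt (p' + t')"
    "nbrs w = translate t' (map ((+) p') (shifts E p'))"
    using nbrs_as_translate[OF zw(2)] by blast
  note u = translate_unique[OF t(1) base_nbrs_mem[OF t(2)] t'(1) base_nbrs_mem[OF t'(2)] xy(1)]
  have "map ((+) p) (shifts E p) = map ((+) p') (shifts E p')" "t mod v = t' mod v"
    using u xy unfolding t(4) t'(4) by blast+
  \<comment> \<open>The two lists begin with 2 and with 5, so equality of the lists identifies the parity.\<close>
  then have "p = p'" "t mod v = t' mod v" using t(2) t'(2) by (auto simp: shifts_def)
  then show ?thesis using t(3) t'(3) by (simp add: pt_add_cancel)
qed

text \<open>A triangle would put an arc inside a neighbourhood, which is a clique of collinear points.
  For connectedness, the steps of length 2 join all even vertices, and every odd vertex has an even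
  neighbour.\<close>
theorem pentagonal_geometry_exists:
  assumes r: "v = 3 * int r + 14"
  shows "\<exists>L. gen_pentagonal_geometry 4 r 13 points L \<and>
     Digraph_Component.connected (with_proj (deficiency_graph points L)) \<and>
     girth (deficiency_graph points L) = 5"
proof -
  have "card points = 3 * r + 14" using r unfolding points_def by (simp add: nat_add_distrib nat_mult_distrib)
  then have "\<exists>L. gen_pentagonal_geometry 4 r 13 points L \<and>
    (\<forall>x\<in>points. \<forall>y\<in>points. x \<noteq> y \<longrightarrow> (collinear_in L x y \<longleftrightarrow> y \<notin> nbrs x))"
    by (rule pentagonal_geometry_from_cliques[where Q = quads])
      (rule nbrs_sub card_nbrs nbrs_irrefl quads_sub card_quad clique_cover clique_sep clique_unique;
       assumption)+
  then obtain L where L: "gen_pentagonal_geometry 4 r 13 points L"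
    and col: "\<And>x y. x \<in> points \<Longrightarrow> y \<in> points \<Longrightarrow> x \<noteq> y \<Longrightarrow> collinear_in L x y \<longleftrightarrow> y \<notin> nbrs x"
    by blast
  let ?G = "deficiency_graph points L"
  have verts: "pverts ?G = points" by (simp add: deficiency_graph_def)
  have nb: "y \<in> points \<and> x \<noteq> y" if "x \<in> points" "y \<in> nbrs x" for x y
    using that nbrs_sub nbrs_irrefl by blast
  have arc: "(x, y) \<in> parcs ?G \<longleftrightarrow> x \<in> points \<and> y \<in> nbrs x" for x y
    unfolding deficiency_graph_def using col[of x y] nb[of x y] by auto
  have pt_arc: "(pt a, pt b) \<in> parcs ?G" if "b - a \<in> set (shifts E a)" for a b
    using pt_nbrs[OF that] unfolding arc by simp
  have wf: "x \<in> pverts ?G \<and> y \<in> pverts ?G" if "(x, y) \<in> parcs ?G" for x y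
    using that nb unfolding arc verts by blast
  obtain e where e: "e \<in> set E" using len_E by fastforce
  then have oe: "odd e" using odd_E by blast
  have "girth ?G = 5"
  proof (rule girth_eq_5I[OF wf, where a = "pt 0" and b = "pt e" and c = "pt (e + 4)" and d = "pt 4" and e = "pt 2"])
    show "(z, x) \<notin> parcs ?G" if "(x, y) \<in> parcs ?G" "(y, z) \<in> parcs ?G" for x y z
    proof
      assume "(z, x) \<in> parcs ?G"
      then have "y \<in> nbrs x" "z \<in> nbrs x" "z \<in> nbrs y" "x \<in> points"
        using that nbrs_sym unfolding arc by blast+
      then show False using clique_sep by blast
    qed
    show "x = z \<or> y = w"
      if "(x, y) \<in> parcs ?G" "(y, z) \<in> parcs ?G" "(z, w) \<in> parcs ?G" "(w, x) \<in> parcs ?G" for x y z w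
      using that nbrs_inj[of y w x z] nbrs_sym unfolding arc by blast
    have "pt 0 \<noteq> pt 2" "pt 0 \<noteq> pt 4" "pt 4 \<noteq> pt 2" "pt e \<noteq> pt (e + 4)"
      using v_gt by (auto simp: pt_eq_iff mod_eq_dvd_iff zdvd_not_zless)
    moreover have "pt a \<noteq> pt b" if "odd (a - b)" for a b
      using that even_v unfolding pt_eq_iff mod_eq_dvd_iff by (metis dvd_trans)
    then have "pt 0 \<noteq> pt e" "pt 0 \<noteq> pt (e + 4)" "pt e \<noteq> pt 4" "pt e \<noteq> pt 2"
      "pt (e + 4) \<noteq> pt 4" "pt (e + 4) \<noteq> pt 2"
      using oe by simp_all
    ultimately show "distinct [pt 0, pt e, pt (e + 4), pt 4, pt 2]" by simp
  qed (use e oe in \<open>auto intro!: pt_arc simp: shifts_def\<close>)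
  moreover have "Digraph_Component.connected (with_proj ?G)"
  proof (rule connected_symmetricI[OF wf, where a = "pt 0"])
    show "(y, x) \<in> parcs ?G" if "(x, y) \<in> parcs ?G" for x y
      using that nbrs_sym nbrs_sub unfolding arc by blast
    interpret wf_digraph "with_proj ?G" using wf by unfold_locales auto
    have extend: "pt 0 \<rightarrow>\<^sup>*\<^bsub>with_proj ?G\<^esub> y" if "pt 0 \<rightarrow>\<^sup>*\<^bsub>with_proj ?G\<^esub> x" "(x, y) \<in> parcs ?G" for x y
      by (rule reachable_adj_trans[OF that(1)]) (use that(2) in simp)
    have ev: "pt 0 \<rightarrow>\<^sup>*\<^bsub>with_proj ?G\<^esub> pt (2 * int k)" for k
    proof (induction k)
      case 0
      then show ?case by (simp add: verts reachable_refl)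
    next
      case (Suc k)
      have "(pt (2 * int k), pt (2 * int (Suc k))) \<in> parcs ?G" by (rule pt_arc) (simp add: shifts_def)
      with Suc.IH show ?case by (rule extend)
    qed
    have even_reach: "pt 0 \<rightarrow>\<^sup>*\<^bsub>with_proj ?G\<^esub> pt a" if "even a" for a
    proof -
      have "even (int (pt a))" using that by simp
      then have "even (pt a)" by (simp only: even_of_nat)
      then obtain k where "pt a = 2 * k" by blast
      then have "pt (2 * int k) = pt a" using pt_int[OF pt_in[of a]] by simp
      then show ?thesis using ev by metis
    qed
    show "pt 0 \<rightarrow>\<^sup>*\<^bsub>with_proj ?G\<^esub> x" if "x \<in> pverts ?G" for x
    proof (cases "even x")
      case True
      then show ?thesis using even_reach[of "int x"] pt_int that verts by simp
    next
      case False
      have "(pt (int x - e), pt (int x)) \<in> parcs ?G"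
        using False oe e by (intro pt_arc) (simp add: shifts_def)
      then have "pt 0 \<rightarrow>\<^sup>*\<^bsub>with_proj ?G\<^esub> pt (int x)"
        using False oe by (intro extend[OF even_reach]) simp_all
      then show ?thesis using pt_int that verts by simp
    qed
    show "pt 0 \<in> pverts ?G" unfolding verts by (rule pt_in)
  qed
  ultimately show ?thesis using L by blast
qed

end

theorem pentagonal_geometry_of_family:
  assumes "difference_family v E Bs" "v = 3 * int r + 14"
  shows "\<exists>(P :: nat set) L. gen_pentagonal_geometry 4 r 13 P L \<and>
     Digraph_Component.connected (with_proj (deficiency_graph P L)) \<and>
     girth (deficiency_graph P L) = 5"
proof -
  interpret cyclic_family v E Bs using assms(1) by unfold_locales
  show ?thesis using pentagonal_geometry_exists[OF assms(2)] by blast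
qed

section \<open>The fourteen difference families\<close>

text \<open>
  The families consist of \<open>(r - 52) / 2\<close> base quadruples.  All but eight or ten of them come in pairs
  exchanged by the involution \<open>2 i \<leftrightarrow> 2 i + 1\<close>.  No family can be invariant under it, because it
  interchanges the two parities, on which the graph has different steps; but \<open>E\<close> is chosen to be
  nearly mapped to itself by the induced map \<open>e \<mapsto> 2 - e\<close>.  The unpaired quadruples make up for the
  asymmetry, and the others solve an exact cover problem of half the size, which makes such
  families easy to find.
\<close>


lemma difference_family_350:
  "difference_family 350 [23, 63, 81, 151, 171, 181, 203, 275, 287, 335, 349]
     [[0, 56, 323, 325], [0, 130, 327, 5], [0, 36, 329, 109], [0, 8, 15, 135], [0, 120, 13, 69],
      [0, 150, 17, 53], [0, 28, 57, 103], [0, 46, 145, 295], [0, 50, 43, 157], [1, 51, 42, 156],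
      [0, 6, 121, 233], [1, 7, 120, 232], [0, 92, 133, 235], [1, 93, 132, 234], [0, 134, 101, 263],
      [1, 135, 100, 262], [0, 54, 93, 159], [1, 55, 92, 158], [0, 34, 315, 45], [1, 35, 314, 44],
      [0, 16, 257, 49], [1, 17, 256, 48], [0, 44, 91, 265], [1, 45, 90, 264], [0, 26, 139, 215],
      [1, 27, 138, 214], [0, 42, 97, 165], [1, 43, 96, 164], [0, 110, 141, 301], [1, 111, 140, 300]]"
  by code_simp

lemma difference_family_362:
  "difference_family 362 [15, 47, 71, 123, 165, 201, 245, 293, 313, 347, 359]
     [[0, 16, 7, 21], [0, 14, 239, 55], [0, 156, 115, 117], [0, 106, 3, 159], [1, 17, 107, 274],
      [0, 134, 273, 9], [0, 8, 98, 231], [0, 178, 319, 91], [0, 60, 23, 95], [1, 61, 22, 94],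
      [0, 10, 263, 37], [1, 11, 262, 36], [0, 28, 107, 177], [1, 29, 106, 176], [0, 38, 99, 209],
      [1, 39, 98, 208], [0, 58, 279, 83], [1, 59, 278, 82], [0, 124, 93, 255], [1, 125, 92, 254],
      [0, 22, 135, 235], [1, 23, 134, 234], [0, 144, 173, 333], [1, 145, 172, 332],
      [0, 26, 103, 207], [1, 27, 102, 206], [0, 40, 137, 219], [1, 41, 136, 218], [0, 6, 283, 63],
      [1, 7, 282, 62], [0, 88, 147, 299], [1, 89, 146, 298]]"
  by code_simp

lemma difference_family_374:
  "difference_family 374 [11, 25, 53, 107, 117, 185, 257, 273, 323, 347, 367]
     [[0, 98, 289, 291], [0, 8, 361, 85], [0, 164, 195, 265], [0, 70, 5, 169], [0, 86, 194, 87],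
      [0, 148, 355, 67], [1, 41, 267, 342], [0, 40, 123, 303], [0, 48, 178, 47], [1, 49, 179, 46],
      [0, 146, 129, 305], [1, 147, 128, 304], [0, 56, 41, 227], [1, 57, 40, 226], [0, 58, 127, 279],
      [1, 59, 126, 278], [0, 30, 281, 91], [1, 31, 280, 90], [0, 46, 81, 203], [1, 47, 80, 202],
      [0, 26, 89, 225], [1, 27, 88, 224], [0, 84, 143, 245], [1, 85, 142, 244], [0, 36, 333, 75],
      [1, 37, 332, 74], [0, 6, 141, 153], [1, 7, 140, 152], [0, 22, 167, 201], [1, 23, 166, 200],
      [0, 100, 65, 237], [1, 101, 64, 236], [0, 118, 163, 283], [1, 119, 162, 282]]"
  by code_simp

lemma difference_family_386:
  "difference_family 386 [17, 31, 81, 135, 157, 225, 255, 311, 355, 371, 383]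
     [[0, 124, 127, 129], [0, 74, 239, 305], [0, 8, 66, 73], [0, 88, 163, 237], [1, 59, 263, 84],
      [1, 89, 191, 152], [0, 182, 349, 45], [0, 82, 196, 233], [0, 134, 281, 9], [0, 102, 209, 343],
      [0, 36, 105, 145], [1, 37, 104, 144], [0, 70, 95, 173], [1, 71, 94, 172], [0, 38, 301, 101],
      [1, 39, 300, 100], [0, 18, 170, 291], [1, 19, 171, 290], [0, 24, 269, 67], [1, 25, 268, 66],
      [0, 26, 49, 213], [1, 27, 48, 212], [0, 80, 91, 271], [1, 81, 90, 270], [0, 10, 123, 217],
      [1, 11, 122, 216], [0, 108, 51, 219], [1, 109, 50, 218], [0, 42, 89, 141], [1, 43, 88, 140],
      [0, 6, 61, 183], [1, 7, 60, 182], [0, 110, 71, 203], [1, 111, 70, 202], [0, 136, 189, 331],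
      [1, 137, 188, 330]]"
  by code_simp

lemma difference_family_398:
  "difference_family 398 [25, 67, 151, 167, 179, 197, 223, 233, 247, 337, 371]
     [[0, 78, 331, 379], [0, 48, 1, 79], [0, 8, 211, 329], [0, 118, 33, 217], [0, 146, 205, 207],
      [0, 108, 87, 157], [1, 109, 253, 210], [0, 70, 214, 173], [0, 88, 327, 91], [1, 89, 326, 90],
      [0, 116, 385, 123], [1, 117, 384, 122], [0, 20, 295, 57], [1, 21, 294, 56], [0, 6, 119, 141],
      [1, 7, 118, 140], [0, 62, 345, 97], [1, 63, 344, 96], [0, 60, 317, 101], [1, 61, 316, 100],
      [0, 58, 210, 325], [1, 59, 211, 324], [0, 132, 137, 271], [1, 133, 136, 270], [0, 38, 47, 145],
      [1, 39, 46, 144], [0, 40, 347, 51], [1, 41, 346, 50], [0, 74, 196, 159], [1, 75, 197, 158],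
      [0, 64, 81, 191], [1, 65, 80, 190], [0, 32, 311, 77], [1, 33, 310, 76], [0, 106, 95, 215],
      [1, 107, 94, 214], [0, 76, 168, 187], [1, 77, 169, 186]]"
  by code_simp

lemma difference_family_410:
  "difference_family 410 [5, 21, 41, 91, 131, 163, 247, 277, 323, 371, 397]
     [[1, 23, 163, 24], [1, 3, 347, 398], [0, 22, 162, 141], [0, 8, 312, 293], [0, 64, 317, 405],
      [0, 66, 137, 235], [0, 88, 200, 85], [0, 166, 177, 283], [0, 132, 403, 193], [1, 113, 279, 60],
      [0, 52, 115, 313], [1, 53, 114, 312], [0, 12, 67, 81], [1, 13, 66, 80], [0, 6, 196, 353],
      [1, 7, 197, 352], [0, 82, 111, 299], [1, 83, 110, 298], [0, 68, 145, 223], [1, 69, 144, 222],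
      [0, 172, 27, 221], [1, 173, 26, 220], [0, 38, 121, 269], [1, 39, 120, 268], [0, 42, 100, 225],
      [1, 43, 101, 224], [0, 96, 201, 303], [1, 97, 200, 302], [0, 24, 75, 239], [1, 25, 74, 238],
      [0, 28, 101, 237], [1, 29, 100, 236], [0, 10, 315, 57], [1, 11, 314, 56], [0, 56, 179, 241],
      [1, 57, 178, 240], [0, 118, 377, 149], [1, 119, 376, 148], [0, 134, 33, 213],
      [1, 135, 32, 212]]"
  by code_simp

lemma difference_family_422:
  "difference_family 422 [5, 17, 45, 115, 157, 207, 217, 273, 307, 381, 403]
     [[0, 8, 419, 421], [0, 146, 295, 409], [0, 14, 315, 39], [0, 114, 242, 265], [0, 136, 389, 147],
      [0, 168, 415, 121], [0, 142, 177, 313], [1, 27, 281, 286], [1, 7, 409, 300], [0, 6, 402, 267],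
      [0, 118, 37, 245], [1, 119, 36, 244], [0, 68, 165, 237], [1, 69, 164, 236], [0, 38, 105, 181],
      [1, 39, 104, 180], [0, 138, 75, 223], [1, 139, 74, 222], [0, 184, 95, 283], [1, 185, 94, 282],
      [0, 16, 69, 251], [1, 17, 68, 250], [0, 62, 144, 393], [1, 63, 145, 392], [0, 18, 77, 107],
      [1, 19, 76, 106], [0, 78, 29, 135], [1, 79, 28, 134], [0, 88, 63, 167], [1, 89, 62, 166],
      [0, 84, 178, 369], [1, 85, 179, 368], [0, 52, 343, 125], [1, 53, 342, 124], [0, 54, 87, 293],
      [1, 55, 86, 292], [0, 44, 124, 323], [1, 45, 125, 322], [0, 32, 103, 229], [1, 33, 102, 228],
      [0, 48, 170, 231], [1, 49, 171, 230]]"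
  by code_simp

lemma difference_family_434:
  "difference_family 434 [91, 119, 129, 151, 193, 237, 289, 307, 319, 343, 431]
     [[0, 204, 283, 349], [1, 35, 111, 188], [0, 66, 73, 75], [0, 34, 358, 361], [0, 92, 201, 405],
      [0, 212, 243, 415], [0, 8, 172, 371], [0, 16, 21, 113], [0, 180, 245, 23], [1, 17, 271, 292],
      [0, 78, 226, 215], [1, 79, 227, 214], [0, 140, 389, 157], [1, 141, 388, 156], [0, 68, 158, 59],
      [1, 69, 159, 58], [0, 40, 175, 225], [1, 41, 174, 224], [0, 98, 85, 271], [1, 99, 84, 270],
      [0, 26, 162, 205], [1, 27, 163, 204], [0, 152, 83, 259], [1, 153, 82, 258], [0, 116, 260, 81],
      [1, 117, 261, 80], [0, 84, 35, 139], [1, 85, 34, 138], [0, 6, 373, 67], [1, 7, 372, 66],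
      [0, 48, 209, 265], [1, 49, 208, 264], [0, 72, 111, 295], [1, 73, 110, 294], [0, 62, 103, 269],
      [1, 63, 102, 268], [0, 14, 134, 183], [1, 15, 135, 182], [0, 20, 379, 45], [1, 21, 378, 44],
      [0, 46, 19, 99], [1, 47, 18, 98], [0, 58, 33, 163], [1, 59, 32, 162]]"
  by code_simp

lemma difference_family_446:
  "difference_family 446 [5, 21, 49, 101, 137, 209, 235, 313, 345, 405, 427]
     [[0, 48, 443, 445], [0, 34, 385, 433], [0, 200, 243, 307], [0, 220, 15, 215], [0, 222, 41, 261],
      [1, 35, 257, 264], [0, 8, 390, 71], [0, 190, 321, 377], [0, 66, 140, 367], [1, 67, 141, 366],
      [0, 54, 130, 415], [1, 55, 131, 414], [0, 6, 180, 329], [1, 7, 181, 328], [0, 30, 175, 275],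
      [1, 31, 174, 274], [0, 162, 189, 353], [1, 163, 188, 352], [0, 70, 159, 271],
      [1, 71, 158, 270], [0, 50, 168, 437], [1, 51, 169, 436], [0, 12, 169, 263], [1, 13, 168, 262],
      [0, 18, 357, 83], [1, 19, 356, 82], [0, 38, 69, 193], [1, 39, 68, 192], [0, 102, 37, 195],
      [1, 103, 36, 194], [0, 84, 57, 143], [1, 85, 56, 142], [0, 128, 117, 327], [1, 129, 116, 326],
      [0, 144, 35, 229], [1, 145, 34, 228], [0, 10, 161, 181], [1, 11, 160, 180], [0, 42, 240, 165],
      [1, 43, 241, 164], [0, 58, 184, 113], [1, 59, 185, 112], [0, 146, 294, 369],
      [1, 147, 295, 368], [0, 14, 129, 295], [1, 15, 128, 294]]"
  by code_simp

lemma difference_family_458: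
  "difference_family 458 [41, 105, 141, 155, 225, 235, 307, 323, 353, 413, 455]
     [[0, 170, 7, 133], [0, 162, 5, 165], [0, 174, 135, 359], [0, 190, 47, 49], [0, 126, 298, 9],
      [0, 8, 119, 291], [1, 29, 297, 310], [0, 28, 262, 79], [1, 93, 263, 298], [0, 92, 299, 15],
      [0, 48, 116, 215], [1, 49, 117, 214], [0, 142, 123, 345], [1, 143, 122, 344],
      [0, 136, 191, 395], [1, 137, 190, 394], [0, 96, 206, 27], [1, 97, 207, 26], [0, 54, 208, 383],
      [1, 55, 209, 382], [0, 26, 164, 281], [1, 27, 165, 280], [0, 134, 63, 219], [1, 135, 62, 218],
      [0, 12, 29, 95], [1, 13, 28, 94], [0, 58, 335, 93], [1, 59, 334, 92], [0, 104, 81, 193],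
      [1, 105, 80, 192], [0, 6, 38, 97], [1, 7, 39, 96], [0, 52, 113, 339], [1, 53, 112, 338],
      [0, 18, 74, 261], [1, 19, 75, 260], [0, 24, 195, 271], [1, 25, 194, 270], [0, 78, 23, 147],
      [1, 79, 22, 146], [0, 40, 127, 249], [1, 41, 126, 248], [0, 62, 393, 75], [1, 63, 392, 74],
      [0, 20, 31, 53], [1, 21, 30, 52], [0, 34, 214, 197], [1, 35, 215, 196]]"
  by code_simp

lemma difference_family_470:
  "difference_family 470 [5, 49, 89, 125, 163, 193, 281, 309, 343, 389, 421]
     [[0, 8, 465, 467], [0, 152, 379, 427], [0, 48, 429, 131], [0, 162, 349, 43], [0, 22, 15, 81],
      [0, 134, 306, 133], [0, 66, 79, 241], [1, 19, 153, 240], [0, 18, 55, 223], [0, 168, 413, 435],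
      [0, 122, 409, 147], [1, 123, 408, 146], [0, 16, 57, 157], [1, 17, 56, 156], [0, 24, 50, 323],
      [1, 25, 51, 322], [0, 6, 20, 418], [1, 7, 21, 419], [0, 64, 190, 289], [1, 65, 191, 288],
      [0, 82, 143, 321], [1, 83, 142, 320], [0, 10, 224, 111], [1, 11, 225, 110], [0, 124, 145, 375],
      [1, 125, 144, 374], [0, 110, 213, 367], [1, 111, 212, 366], [0, 70, 268, 407],
      [1, 71, 269, 406], [0, 56, 35, 95], [1, 57, 34, 94], [0, 128, 203, 363], [1, 129, 202, 362],
      [0, 42, 335, 69], [1, 43, 334, 68], [0, 136, 284, 317], [1, 137, 285, 316], [0, 12, 29, 229],
      [1, 13, 28, 228], [0, 90, 209, 301], [1, 91, 208, 300], [0, 96, 31, 265], [1, 97, 30, 264],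
      [0, 102, 113, 219], [1, 103, 112, 218], [0, 94, 19, 201], [1, 95, 18, 200], [0, 142, 73, 295],
      [1, 143, 72, 294]]"
  by code_simp

lemma difference_family_482:
  "difference_family 482 [5, 39, 99, 143, 155, 179, 303, 325, 343, 391, 445]
     [[0, 198, 309, 383], [0, 108, 381, 481], [0, 8, 390, 479], [0, 240, 331, 333],
      [0, 74, 268, 211], [1, 47, 241, 470], [0, 222, 385, 477], [0, 46, 475, 207],
      [0, 176, 231, 453], [1, 109, 285, 254], [0, 106, 81, 215], [1, 107, 80, 214],
      [0, 78, 107, 197], [1, 79, 106, 196], [0, 72, 156, 25], [1, 73, 157, 24], [0, 50, 335, 73],
      [1, 51, 334, 72], [0, 10, 30, 201], [1, 11, 31, 200], [0, 6, 118, 75], [1, 7, 119, 74],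
      [0, 14, 223, 251], [1, 15, 222, 250], [0, 32, 115, 267], [1, 33, 114, 266], [0, 132, 165, 371],
      [1, 133, 164, 370], [0, 114, 272, 53], [1, 115, 273, 52], [0, 26, 11, 213], [1, 27, 10, 212],
      [0, 82, 250, 129], [1, 83, 251, 128], [0, 62, 379, 127], [1, 63, 378, 126], [0, 16, 219, 257],
      [1, 17, 218, 256], [0, 68, 166, 51], [1, 69, 167, 50], [0, 58, 407, 79], [1, 59, 406, 78],
      [0, 52, 224, 311], [1, 53, 225, 310], [0, 86, 208, 279], [1, 87, 209, 278], [0, 70, 85, 195],
      [1, 71, 84, 194], [0, 64, 417, 121], [1, 65, 416, 120], [0, 126, 254, 315], [1, 127, 255, 314]]"
  by code_simp

lemma difference_family_494:
  "difference_family 494 [23, 67, 171, 185, 213, 287, 309, 325, 431, 467, 491]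
     [[0, 52, 477, 61], [0, 244, 29, 31], [1, 19, 245, 40], [0, 226, 207, 259], [0, 18, 315, 7],
      [0, 8, 316, 13], [0, 196, 237, 415], [0, 78, 81, 277], [0, 12, 84, 353], [1, 13, 85, 352],
      [0, 76, 156, 111], [1, 77, 157, 110], [0, 32, 114, 377], [1, 33, 115, 376], [0, 54, 389, 127],
      [1, 55, 388, 126], [0, 34, 129, 299], [1, 35, 128, 298], [0, 20, 117, 245], [1, 21, 116, 244],
      [0, 62, 149, 363], [1, 63, 148, 362], [0, 46, 403, 131], [1, 47, 402, 130], [0, 48, 101, 295],
      [1, 49, 100, 294], [0, 40, 200, 421], [1, 41, 201, 420], [0, 58, 141, 351], [1, 59, 140, 350],
      [0, 100, 177, 361], [1, 101, 176, 360], [0, 90, 179, 343], [1, 91, 178, 342], [0, 6, 132, 43],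
      [1, 7, 133, 42], [0, 10, 66, 123], [1, 11, 67, 122], [0, 68, 59, 193], [1, 69, 58, 192],
      [0, 150, 318, 417], [1, 151, 319, 416], [0, 30, 202, 45], [1, 31, 203, 44], [0, 92, 147, 257],
      [1, 93, 146, 256], [0, 224, 105, 333], [1, 225, 104, 332], [0, 64, 152, 103],
      [1, 65, 153, 102], [0, 98, 206, 255], [1, 99, 207, 254], [0, 120, 256, 479],
      [1, 121, 257, 478]]"
  by code_simp

lemma difference_family_506:
  "difference_family 506 [13, 37, 109, 157, 217, 293, 351, 403, 465, 493, 503]
     [[0, 8, 82, 51], [0, 14, 397, 471], [0, 206, 211, 225], [0, 56, 101, 103], [1, 89, 207, 82],
      [0, 118, 201, 283], [0, 166, 453, 3], [0, 88, 395, 55], [0, 6, 202, 251], [1, 7, 203, 250],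
      [0, 68, 183, 329], [1, 69, 182, 328], [0, 18, 104, 135], [1, 19, 105, 134], [0, 224, 199, 427],
      [1, 225, 198, 426], [0, 34, 409, 93], [1, 35, 408, 92], [0, 20, 148, 279], [1, 21, 149, 278],
      [0, 80, 238, 361], [1, 81, 239, 360], [0, 66, 240, 445], [1, 67, 241, 444], [0, 46, 234, 67],
      [1, 47, 235, 66], [0, 22, 95, 189], [1, 23, 94, 188], [0, 12, 42, 185], [1, 13, 43, 184],
      [0, 70, 154, 387], [1, 71, 155, 386], [0, 162, 223, 439], [1, 163, 222, 438],
      [0, 36, 181, 357], [1, 37, 180, 356], [0, 126, 57, 265], [1, 127, 56, 264], [0, 64, 89, 271],
      [1, 65, 88, 270], [0, 106, 23, 255], [1, 107, 22, 254], [0, 124, 262, 177], [1, 125, 263, 176],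
      [0, 92, 222, 29], [1, 93, 223, 28], [0, 32, 164, 241], [1, 33, 165, 240], [0, 98, 254, 333],
      [1, 99, 255, 332], [0, 102, 193, 371], [1, 103, 192, 370], [0, 44, 163, 381],
      [1, 45, 162, 380], [0, 214, 75, 311], [1, 215, 74, 310]]"
  by code_simp

theorem lemma4p1:
  fixes r :: nat
  assumes "r \<in> {112, 116, 120, 124, 128, 132, 136, 140, 144, 148, 152, 156, 160, 164}"
  shows "\<exists>(P :: nat set) L.
           gen_pentagonal_geometry 4 r 13 P L \<and>
           Digraph_Component.connected (with_proj (deficiency_graph P L)) \<and>
           girth (deficiency_graph P L) = 5"
  by (insert assms, elim insertE emptyE,
      rule pentagonal_geometry_of_family[OF difference_family_350], simp,
      rule pentagonal_geometry_of_family[OF difference_family_362], simp,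
      rule pentagonal_geometry_of_family[OF difference_family_374], simp,
      rule pentagonal_geometry_of_family[OF difference_family_386], simp,
      rule pentagonal_geometry_of_family[OF difference_family_398], simp,
      rule pentagonal_geometry_of_family[OF difference_family_410], simp,
      rule pentagonal_geometry_of_family[OF difference_family_422], simp,
      rule pentagonal_geometry_of_family[OF difference_family_434], simp,
      rule pentagonal_geometry_of_family[OF difference_family_446], simp,
      rule pentagonal_geometry_of_family[OF difference_family_458], simp,
      rule pentagonal_geometry_of_family[OF difference_family_470], simp,
      rule pentagonal_geometry_of_family[OF difference_family_482], simp,
      rule pentagonal_geometry_of_family[OF difference_family_494], simp,
      rule pentagonal_geometry_of_family[OF difference_family_506], simp)

end
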